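(* Let $n\geq 3$, let $m,q\in\mathbb{N}$ (positive integers) with $mq=n$, and let $M$ be an $n\times n$ extremal symmetric bistochastic matrix (an extreme point of the convex set of $n\times n$ symmetric bistochastic matrices) having $q$ Katz blocks, all of which are $m\times m$. Then $\rho_{n,2}M+(1-\rho_{n,2})W_n\in\mathcal{B}_n^h$.
   Context: A symmetric bistochastic matrix is a symmetric real matrix with nonnegative entries all of whose rows and columns sum to $1$. $W_n$ denotes the $n\times n$ matrix all of whose entries are $\frac1n$. An $n\times n$ matrix is $H$-unistochastic if its $(i,j)$ entry is $|u_{ij}|^2$ for all $i,j$, where $U=(u_{ij})$ is some $n\times n$ complex matrix that is both Hermitian and unitary; $\mathcal{B}_n^h$ is the convex hull of the $n\times n$ $H$-unistochastic matrices. Katz blocks: By a theorem of Katz, an $n\times n$ matrix $M$ is an extreme point of the convex set of $n\times n$ symmetric bistochastic matrices if and only if there is a permutation matrix $P$ such that $PMP^T$ is block diagonal with diagonal blocks $B_{n_1},\dots,B_{n_s}$, where $s\ge1$, $n_1+\dots+n_s=n$, each $n_k$ is either odd or equal to $2$, and $B_1=(1)$, $B_2=\begin{pmatrix}0&1\\1&0\end{pmatrix}$, and for odd $k\ge 3$, $B_k$ is the $k\times k$ matrix whose $(i,j)$ entry is $\frac12$ if $i-j\equiv\pm1\pmod k$ and $0$ otherwise. The blocks $B_{n_k}$ are called the Katz blocks of $M$. Thus the hypothesis on $M$ says that $M$ is permutation similar to the block diagonal matrix with $q$ diagonal blocks each equal to $B_m$ ($m$ odd or $m=2$). A real correlation matrix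 is a real symmetric positive semidefinite matrix all of whose diagonal entries equal $1$. $\rho_{n,r}$ denotes the largest positive number less than or equal to one for which $\rho_{n,r}C+(1-\rho_{n,r})I_n$ is in the convex hull of the $n\times n$ real rank one correlation matrices whenever $C$ is an $n\times n$ real correlation matrix of rank at most $r$. *)

theory Defs
  imports "HOL-Analysis.Analysis" "HOL-Number_Theory.Cong"
begin

definition symmetric_bistochastic :: "real ^ 'n ^ 'n \<Rightarrow> bool" where
  "symmetric_bistochastic A \<longleftrightarrow>
     transpose A = A \<and>
     (\<forall>i j. 0 \<le> A $ i $ j) \<and>
     (\<forall>i. (\<Sum>j\<in>UNIV. A $ i $ j) = 1) \<and>
     (\<forall>j. (\<Sum>i\<in>UNIV. A $ i $ j) = 1)"

definition W_mat :: "real ^ 'n ^ 'n" where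
  "W_mat = (\<chi> i j. 1 / real CARD('n))"

definition conj_transpose :: "complex ^ 'n ^ 'm \<Rightarrow> complex ^ 'm ^ 'n" where
  "conj_transpose U = (\<chi> i j. cnj (U $ j $ i))"

definition hermitian_mat :: "complex ^ 'n ^ 'n \<Rightarrow> bool" where
  "hermitian_mat U \<longleftrightarrow> conj_transpose U = U"

definition unitary_mat :: "complex ^ 'n ^ 'n \<Rightarrow> bool" where
  "unitary_mat U \<longleftrightarrow> U ** conj_transpose U = mat 1 \<and> conj_transpose U ** U = mat 1"

definition H_unistochastic :: "real ^ 'n ^ 'n \<Rightarrow> bool" where
  "H_unistochastic A \<longleftrightarrow>
     (\<exists>U :: complex ^ 'n ^ 'n. hermitian_mat U \<and> unitary_mat U \<and>
        (\<forall>i j. A $ i $ j = (cmod (U $ i $ j))\<^sup>2))"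

definition B_h :: "(real ^ 'n ^ 'n) set" where
  "B_h = convex hull {A. H_unistochastic A}"

text \<open>
  The entries of the blocks are indexed from 0; they depend only on differences of indices.
  The sizes 1 and 2 are exceptional: there 1 and -1 are congruent modulo the size.
\<close>

definition katz_block :: "nat \<Rightarrow> nat \<Rightarrow> nat \<Rightarrow> real" where
  "katz_block k i j =
     (if k = 1 then 1
      else if k = 2 then (if i = j then 0 else 1)
      else if [int i - int j = 1] (mod int k) \<or> [int i - int j = - 1] (mod int k) then 1 / 2
      else 0)"

text \<open>
  \<open>block_diag ns i j\<close> is the entry at \<open>(i, j)\<close>, for \<open>i, j < sum_list ns\<close>, of the block diagonal
  matrix whose successive diagonal blocks are the Katz blocks of the sizes listed in \<open>ns\<close>.
\<close>

fun block_diag :: "nat list \<Rightarrow> nat \<Rightarrow> nat \<Rightarrow> real" where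
  "block_diag [] i j = 0"
| "block_diag (k # ns) i j =
     (if i < k \<and> j < k then katz_block k i j
      else if k \<le> i \<and> k \<le> j then block_diag ns (i - k) (j - k)
      else 0)"

text \<open>
  A finite index type carries no order of its own. To speak of successive blocks we number it by
  \<open>to_nat_on UNIV\<close>, a bijection from \<open>UNIV\<close> to \<open>{..<CARD('n)}\<close>. Which bijection
  is used does not matter below, since matrices are considered up to permutation similarity.
\<close>

definition katz_matrix :: "nat list \<Rightarrow> real ^ 'n ^ 'n" where
  "katz_matrix ns =
     (\<chi> i j. block_diag ns (to_nat_on (UNIV :: 'n set) i) (to_nat_on (UNIV :: 'n set) j))"

definition permutation_matrix :: "real ^ 'n ^ 'n \<Rightarrow> bool" where
  "permutation_matrix P \<longleftrightarrow>
     (\<exists>p. p permutes (UNIV :: 'n set) \<and> P = (\<chi> i j. if j = p i then 1 else 0))"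

definition has_katz_blocks :: "real ^ 'n ^ 'n \<Rightarrow> nat list \<Rightarrow> bool" where
  "has_katz_blocks M ns \<longleftrightarrow>
     ns \<noteq> [] \<and> sum_list ns = CARD('n) \<and> (\<forall>k \<in> set ns. odd k \<or> k = 2) \<and>
     (\<exists>P. permutation_matrix P \<and> P ** M ** transpose P = katz_matrix ns)"

definition correlation_matrix :: "real ^ 'n ^ 'n \<Rightarrow> bool" where
  "correlation_matrix C \<longleftrightarrow>
     transpose C = C \<and> (\<forall>x. 0 \<le> x \<bullet> (C *v x)) \<and> (\<forall>i. C $ i $ i = 1)"

text \<open>
  The matrix size is passed as a type: \<open>rho TYPE('n) r\<close> is $\rho_{n,r}$ with \<open>n = CARD('n)\<close>.
  The set of admissible \<open>t\<close> is nonempty, since the identity matrix is a relative interior point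
  of the hull in the unit-diagonal symmetric matrices, and has a greatest element, since the hull
  of the finitely many rank one correlation matrices is closed.
\<close>

definition rho :: "'n::finite itself \<Rightarrow> nat \<Rightarrow> real" where
  "rho (_ :: 'n itself) r =
     (GREATEST t. 0 < t \<and> t \<le> 1 \<and>
        (\<forall>C :: real ^ 'n ^ 'n. correlation_matrix C \<and> rank C \<le> r \<longrightarrow>
           t *\<^sub>R C + (1 - t) *\<^sub>R mat 1
             \<in> convex hull {D :: real ^ 'n ^ 'n. correlation_matrix D \<and> rank D = 1}))"

end

theory Submission
  imports Defs "HOL-Library.Real_Mod"
begin

text \<open>
  Let \<open>V\<close> be a unitary matrix. Conjugating a diagonal matrix of signs \<open>v\<close> by \<open>V\<close> gives a Hermitian
  unitary matrix, and the squared moduli of its entries depend linearly on the rank one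
  correlation matrix \<open>v v\<^sup>T\<close>. Hence there is a linear map \<open>spectral_lift V\<close> on real matrices that
  sends the rank one correlation matrices to \<open>H\<close>-unistochastic ones, and so sends their
  convex hull into \<open>B_h\<close>.

  Now choose \<open>V\<close> to be the Fourier matrix of the group \<open>\<int>/m \<times> \<int>/q\<close>. The identity matrix is sent
  to \<open>W_mat\<close>, because all entries of \<open>V\<close> have the same modulus. The Katz matrix with \<open>q\<close> blocks of
  size \<open>m\<close> is the average of the translations by \<open>(1, 0)\<close> and \<open>(-1, 0)\<close> of this group, so on the
  Fourier side it comes from the multiplier \<open>k \<mapsto> cos (2\<pi> k\<^sub>1 / m)\<close>: it is the image of the
  correlation matrix \<open>C\<close> with entries \<open>cos (2\<pi> (k\<^sub>1 - l\<^sub>1) / m)\<close>. The addition theorem writes \<open>C\<close> as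
  a sum of two rank one matrices, so its rank is at most 2. By the defining property of
  \<open>\<rho> = rho TYPE('n) 2\<close>, the matrix \<open>\<rho> C + (1 - \<rho>) I\<close> lies in the hull of the rank one correlation
  matrices; its image is \<open>\<rho> M + (1 - \<rho>) W\<close>.

  The defining property of \<open>\<rho>\<close> is available only if the greatest admissible factor exists. The rank
  one correlation matrices are the finitely many \<open>v v\<^sup>T\<close> with \<open>v\<close> a sign vector, so their hull is
  compact and the admissible factors form a closed set; that some positive factor is
  admissible is shown by the explicit value \<open>1 / n\<^sup>2\<close>.
\<close>

section \<open>Rank one correlation matrices\<close>

definition outer :: "real ^ 'n \<Rightarrow> real ^ 'n ^ 'n" where
  "outer v = (\<chi> i j. v $ i * v $ j)"

definition sign_vectors :: "(real ^ 'n) set" where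
  "sign_vectors = {v. \<forall>i. v $ i = 1 \<or> v $ i = -1}"

lemma finite_sign_vectors: "finite (sign_vectors :: (real ^ 'n) set)"
proof -
  have "v \<in> range (\<lambda>S. \<chi> i. if i \<in> S then 1 else -1)"
    if "v \<in> sign_vectors" for v :: "real ^ 'n"
  proof
    show "v = (\<chi> i. if i \<in> {i. v $ i = 1} then 1 else -1)"
      using that by (auto simp: vec_eq_iff sign_vectors_def)
  qed simp
  then have "sign_vectors \<subseteq> range (\<lambda>S :: 'n set. \<chi> i. if i \<in> S then 1 else (-1::real))"
    by blast
  then show ?thesis
    by (rule finite_subset) simp
qed

lemma outer_mult_vector: "outer v *v x = (v \<bullet> x) *\<^sub>R v"
  by (simp add: vec_eq_iff outer_def matrix_vector_mult_def inner_vec_def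
      sum_distrib_left sum_distrib_right mult_ac)

lemma correlation_matrix_sum_outer:
  assumes "\<And>i. (a $ i)\<^sup>2 + (b $ i)\<^sup>2 = 1"
  shows "correlation_matrix (outer a + outer b)"
  unfolding correlation_matrix_def
proof (intro conjI allI)
  show "transpose (outer a + outer b) = outer a + outer b"
    by (simp add: transpose_def vec_eq_iff outer_def mult.commute)
  show "0 \<le> x \<bullet> ((outer a + outer b) *v x)" for x
  proof -
    have "x \<bullet> ((outer a + outer b) *v x) = (a \<bullet> x)\<^sup>2 + (b \<bullet> x)\<^sup>2"
      by (simp add: matrix_vector_mult_add_rdistrib outer_mult_vector inner_add_right
          inner_commute power2_eq_square)
    then show ?thesis by simp
  qed
  show "(outer a + outer b) $ i $ i = 1" for i
    using assms[of i] by (simp add: outer_def power2_eq_square)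
qed

lemma rank_sum_outer: "rank (outer a + outer b) \<le> 2"
proof -
  have "range (\<lambda>x. (outer a + outer b) *v x) \<subseteq> span {a, b}"
  proof clarify
    fix x
    have "(outer a + outer b) *v x = (a \<bullet> x) *\<^sub>R a + (b \<bullet> x) *\<^sub>R b"
      by (simp add: matrix_vector_mult_add_rdistrib outer_mult_vector)
    also have "\<dots> \<in> span {a, b}"
      by (intro span_add span_scale span_base) auto
    finally show "(outer a + outer b) *v x \<in> span {a, b}" .
  qed
  then have "rank (outer a + outer b) \<le> card {a, b}"
    unfolding rank_dim_range by (intro dim_le_card) auto
  also have "\<dots> \<le> 2" by (simp add: card_insert_if)
  finally show ?thesis .
qed

text \<open>
  A rank one matrix has entries \<open>a\<^sub>i w\<^sub>j\<close>; symmetry and the unit diagonal force all \<open>w\<^sub>j\<^sup>2\<close> to agree,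
  so that \<open>w\<close> is a sign vector up to a scalar.
\<close>

lemma rank_one_correlation_matrices:
  "{D :: real ^ 'n ^ 'n. correlation_matrix D \<and> rank D = 1} = outer ` sign_vectors"
proof (intro equalityI subsetI)
  fix D :: "real ^ 'n ^ 'n"
  assume "D \<in> {D. correlation_matrix D \<and> rank D = 1}"
  then have sym: "D $ i $ j = D $ j $ i" and diag: "D $ i $ i = 1" and rk: "rank D = 1" for i j
    unfolding correlation_matrix_def transpose_def by (auto simp: vec_eq_iff)
  obtain B where B: "range (\<lambda>x. D *v x) \<subseteq> span B" "card B = 1"
    using basis_exists[of "range (\<lambda>x. D *v x)"] rk unfolding rank_dim_range by metis
  then obtain w where "B = {w}" by (auto simp: card_1_singleton_iff)
  then have "\<exists>c. D *v axis j 1 = c *\<^sub>R w" for j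
    using B(1) by (auto simp: span_singleton)
  then obtain a where a: "\<And>j. column j D = a j *\<^sub>R w"
    unfolding matrix_vector_mult_basis by metis
  have D: "D $ i $ j = a j * w $ i" for i j
    using a[of j] by (simp add: column_def vec_eq_iff)
  have aw: "a i * w $ i = 1" for i using diag[of i] D by simp
  have wsq: "(w $ i)\<^sup>2 = (w $ j)\<^sup>2" for i j
  proof -
    have "a j * w $ i = a i * w $ j" using sym[of i j] D by simp
    then have "(a j * w $ j) * (w $ i)\<^sup>2 = (a i * w $ i) * (w $ j)\<^sup>2"
      by (simp add: power2_eq_square mult_ac)
    then show ?thesis by (simp add: aw)
  qed
  define s where "s = \<bar>w $ undefined\<bar>"
  have abs_w: "\<bar>w $ i\<bar> = s" for i
    using wsq[of i undefined] by (simp add: s_def power2_eq_iff abs_eq_iff)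
  have s0: "s \<noteq> 0" using aw[of undefined] by (auto simp: s_def)
  define v where "v = (\<chi> i. w $ i / s)"
  have "v \<in> sign_vectors"
    unfolding sign_vectors_def
  proof (intro CollectI allI)
    show "v $ i = 1 \<or> v $ i = -1" for i
      using abs_w[of i] s0 by (auto simp: v_def abs_if split: if_splits)
  qed
  moreover have "D = outer v"
  proof -
    have "D $ i $ j = v $ i * v $ j" for i j
    proof -
      have "w $ j * w $ j = s * s" using abs_w[of j] by (metis abs_mult_self_eq)
      then have "a j * s * s = w $ j" using aw[of j] by (metis mult.assoc mult_1)
      then show ?thesis using s0 D[of i j] by (simp add: v_def field_simps)
    qed
    then show ?thesis by (simp add: vec_eq_iff outer_def)
  qed
  ultimately show "D \<in> outer ` sign_vectors" by blast
next
  fix D :: "real ^ 'n ^ 'n"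
  assume "D \<in> outer ` sign_vectors"
  then obtain v where v: "v \<in> sign_vectors" and D: "D = outer v" by blast
  have sq: "(v $ i)\<^sup>2 = 1" for i
    using v unfolding sign_vectors_def by (auto simp: power2_eq_1_iff)
  have zero: "outer 0 = (0 :: real ^ 'n ^ 'n)" by (simp add: outer_def vec_eq_iff)
  have "correlation_matrix D"
    using correlation_matrix_sum_outer[of v 0] sq unfolding D zero by simp
  moreover have "rank D = 1"
  proof -
    have "range (\<lambda>x. D *v x) \<subseteq> span {v}"
    proof clarify
      fix x
      show "D *v x \<in> span {v}"
        unfolding D outer_mult_vector by (intro span_scale span_base) simp
    qed
    then have "rank D \<le> card {v}"
      unfolding rank_dim_range by (intro dim_le_card) auto
    moreover have "D $ undefined $ undefined = 1"
      using sq[of undefined] by (simp add: D outer_def power2_eq_square)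
    then have "rank D \<noteq> 0" unfolding rank_eq_0 by auto
    ultimately show ?thesis by simp
  qed
  ultimately show "D \<in> {D. correlation_matrix D \<and> rank D = 1}" by simp
qed

text \<open>Positivity on the vectors \<open>e\<^sub>i \<plusminus> e\<^sub>j\<close> bounds the entries.\<close>

lemma correlation_matrix_entry_bound:
  assumes "correlation_matrix C"
  shows "\<bar>C $ i $ j\<bar> \<le> 1"
proof -
  have sym: "C $ j $ i = C $ i $ j" and diag: "C $ i $ i = 1" "C $ j $ j = 1"
    and pos: "0 \<le> x \<bullet> (C *v x)" for x
    using assms unfolding correlation_matrix_def transpose_def by (auto simp: vec_eq_iff)
  have entry: "axis k 1 \<bullet> (C *v axis l 1) = C $ k $ l" for k l
    by (simp add: matrix_vector_mult_basis inner_axis' column_def)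
  have "0 \<le> 2 + 2 * C $ i $ j"
    using pos[of "axis i 1 + axis j 1"]
    by (simp add: matrix_vector_right_distrib inner_add_left inner_add_right entry diag sym)
  moreover have "0 \<le> 2 - 2 * C $ i $ j"
    using pos[of "axis i 1 - axis j 1"]
    by (simp add: matrix_vector_mult_diff_distrib inner_diff_left inner_diff_right entry diag sym)
  ultimately show ?thesis by linarith
qed

section \<open>Attainment of the extremal factor\<close>

lemma sign_conjugate_in_hull:
  fixes X :: "real ^ 'n ^ 'n"
  assumes X: "X \<in> convex hull (outer ` sign_vectors)" and s: "s \<in> sign_vectors"
  shows "(\<chi> i j. s $ i * s $ j * X $ i $ j) \<in> convex hull (outer ` sign_vectors)"
proof -
  let ?f = "\<lambda>X :: real ^ 'n ^ 'n. \<chi> i j. s $ i * s $ j * X $ i $ j"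
  have "linear ?f"
    by (rule linearI) (simp_all add: vec_eq_iff distrib_left mult_ac)
  moreover have "?f ` outer ` sign_vectors \<subseteq> outer ` sign_vectors"
  proof clarify
    fix v :: "real ^ 'n" assume v: "v \<in> sign_vectors"
    have "(\<chi> i. s $ i * v $ i) \<in> sign_vectors"
      unfolding sign_vectors_def
    proof (intro CollectI allI)
      fix i
      have "s $ i = 1 \<or> s $ i = -1" "v $ i = 1 \<or> v $ i = -1"
        using s v unfolding sign_vectors_def by blast+
      then show "(\<chi> i. s $ i * v $ i) $ i = 1 \<or> (\<chi> i. s $ i * v $ i) $ i = -1"
        by auto
    qed
    moreover have "?f (outer v) = outer (\<chi> i. s $ i * v $ i)"
      by (simp add: outer_def vec_eq_iff mult_ac)
    ultimately show "?f (outer v) \<in> outer ` sign_vectors" by simp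
  qed
  ultimately have "?f ` (convex hull (outer ` sign_vectors)) \<subseteq> convex hull (outer ` sign_vectors)"
    by (simp only: convex_hull_linear_image hull_mono)
  moreover have "?f X \<in> ?f ` (convex hull (outer ` sign_vectors))"
    using X by (rule imageI)
  ultimately show ?thesis by (rule subsetD)
qed

text \<open>
  Averaging a matrix of the hull with its conjugate by the diagonal sign matrix that is negative
  only at \<open>a\<close> erases the off-diagonal entries in row and column \<open>a\<close>; this is repeated for each \<open>a\<close>
  in \<open>S\<close>.
\<close>

lemma erase_in_hull:
  assumes X: "X \<in> convex hull (outer ` sign_vectors)" and "finite S"
  shows "(\<chi> k l. if k \<noteq> l \<and> (k \<in> S \<or> l \<in> S) then 0 else X $ k $ l)
           \<in> convex hull (outer ` sign_vectors)"
  using \<open>finite S\<close>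
proof (induction S rule: finite_induct)
  case empty
  then show ?case using X by simp
next
  case (insert a S)
  define Y where "Y = (\<chi> k l. if k \<noteq> l \<and> (k \<in> S \<or> l \<in> S) then 0 else X $ k $ l)"
  define s where "s = (\<chi> i. if i = a then -1 else (1::real))"
  have Y: "Y \<in> convex hull (outer ` sign_vectors)"
    using insert.IH unfolding Y_def .
  have "s \<in> sign_vectors" by (simp add: s_def sign_vectors_def)
  with Y have "(\<chi> i j. s $ i * s $ j * Y $ i $ j) \<in> convex hull (outer ` sign_vectors)"
    by (rule sign_conjugate_in_hull)
  with Y have "(1/2) *\<^sub>R Y + (1/2) *\<^sub>R (\<chi> i j. s $ i * s $ j * Y $ i $ j)
               \<in> convex hull (outer ` sign_vectors)"
    by (rule convexD[OF convex_convex_hull]) simp_all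
  moreover have "(1/2) *\<^sub>R Y + (1/2) *\<^sub>R (\<chi> i j. s $ i * s $ j * Y $ i $ j) =
      (\<chi> k l. if k \<noteq> l \<and> (k \<in> insert a S \<or> l \<in> insert a S) then 0 else X $ k $ l)"
    unfolding vec_eq_iff
  proof (intro allI)
    fix k l
    consider "k = l" | "k \<noteq> l" "k \<in> S \<or> l \<in> S" | "k \<noteq> l" "k = a \<or> l = a" "k \<notin> S" "l \<notin> S"
      | "k \<noteq> l" "k \<noteq> a" "l \<noteq> a" "k \<notin> S" "l \<notin> S"
      by blast
    then show "((1/2) *\<^sub>R Y + (1/2) *\<^sub>R (\<chi> i j. s $ i * s $ j * Y $ i $ j)) $ k $ l =
      (\<chi> k l. if k \<noteq> l \<and> (k \<in> insert a S \<or> l \<in> insert a S) then 0 else X $ k $ l) $ k $ l"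
      by cases (auto simp: Y_def s_def)
  qed
  ultimately show ?case by (simp only:)
qed

text \<open>
  For \<open>i \<noteq> j\<close>, erasing from \<open>v v\<^sup>T\<close> the off-diagonal entries outside the block of \<open>i\<close> and \<open>j\<close> leaves
  only the sign \<open>v\<^sub>i v\<^sub>j\<close> off the diagonal, and every \<open>c\<close> in \<open>[-1, 1]\<close> is a weighted average of the two
  signs.
\<close>

lemma single_pair_in_hull:
  assumes c: "\<bar>c\<bar> \<le> 1"
  shows "(\<chi> k l. if k = l then 1 else if {k, l} = {i, j} then c else 0)
           \<in> convex hull (outer ` (sign_vectors :: (real ^ 'n) set))"
proof -
  define S where "S = - {i, j}"
  define Y where "Y v = (\<chi> k l. if k \<noteq> l \<and> (k \<in> S \<or> l \<in> S) then 0 else outer v $ k $ l)"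
    for v :: "real ^ 'n"
  have Y: "Y v \<in> convex hull (outer ` sign_vectors)" if "v \<in> sign_vectors" for v
    unfolding Y_def by (intro erase_in_hull hull_inc imageI that finite)
  define u :: "real ^ 'n" where "u = (\<chi> k. 1)"
  define w :: "real ^ 'n" where "w = (\<chi> k. if k = i then -1 else 1)"
  have uw: "u \<in> sign_vectors" "w \<in> sign_vectors" by (simp_all add: u_def w_def sign_vectors_def)
  obtain \<alpha> \<beta> :: real where ab: "0 \<le> \<alpha>" "0 \<le> \<beta>" "\<alpha> + \<beta> = 1" and c_eq: "c = \<alpha> - \<beta>"
  proof
    show "0 \<le> (1 + c)/2" "0 \<le> (1 - c)/2" using c by (simp_all add: abs_le_iff)
    show "(1 + c)/2 + (1 - c)/2 = 1" "c = (1 + c)/2 - (1 - c)/2" by (simp_all add: field_simps)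
  qed
  have "\<alpha> *\<^sub>R Y u + \<beta> *\<^sub>R Y w \<in> convex hull (outer ` sign_vectors)"
    by (rule convexD[OF convex_convex_hull Y[OF uw(1)] Y[OF uw(2)] ab])
  moreover have "(\<alpha> *\<^sub>R Y u + \<beta> *\<^sub>R Y w) $ k $ l =
      (if k = l then 1 else if {k, l} = {i, j} then c else 0)" for k l
  proof -
    consider (diag) "k = l" | (pair) "k \<noteq> l" "{k, l} = {i, j}" "k \<notin> S" "l \<notin> S"
      | (rest) "k \<noteq> l" "{k, l} \<noteq> {i, j}" "k \<in> S \<or> l \<in> S"
      unfolding S_def by blast
    then show ?thesis
    proof cases
      case diag
      have "w $ l * w $ l = 1" by (simp add: w_def)
      then show ?thesis using diag ab(3) by (simp add: Y_def u_def outer_def)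
    next
      case pair
      then have "w $ k * w $ l = -1" by (auto simp: w_def doubleton_eq_iff)
      then show ?thesis using pair by (simp add: Y_def u_def outer_def c_eq)
    next
      case rest
      then show ?thesis by (simp add: Y_def)
    qed
  qed
  then have "\<alpha> *\<^sub>R Y u + \<beta> *\<^sub>R Y w =
      (\<chi> k l. if k = l then 1 else if {k, l} = {i, j} then c else 0)"
    by (simp only: vec_eq_iff vec_lambda_beta simp_thms)
  ultimately show ?thesis by (simp only:)
qed

text \<open>
  Averaging the matrices of \<open>single_pair_in_hull\<close> over all \<open>n\<^sup>2\<close> pairs \<open>(i, j)\<close>, with the entry
  \<open>C\<^sub>i\<^sub>j / 2\<close> because each unordered pair occurs twice, gives \<open>C\<close> with its off-diagonal part divided by
  \<open>n\<^sup>2\<close>.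
\<close>

lemma shrunk_correlation_matrix_in_hull:
  fixes C :: "real ^ 'n ^ 'n"
  assumes C: "correlation_matrix C"
  defines "t \<equiv> 1 / (real CARD('n))\<^sup>2"
  shows "t *\<^sub>R C + (1 - t) *\<^sub>R mat 1 \<in> convex hull (outer ` sign_vectors)"
proof -
  define Z where "Z = (\<lambda>(i, j). \<chi> k l. if k = l then 1 else
      if {k, l} = {i, j} then C $ i $ j / 2 else (0::real) :: real ^ 'n ^ 'n)"
  have sym: "C $ j $ i = C $ i $ j" and diag: "C $ i $ i = 1" for i j
    using C unfolding correlation_matrix_def transpose_def by (auto simp: vec_eq_iff)
  have card: "(\<Sum>p\<in>(UNIV :: ('n \<times> 'n) set). t) = 1"
    by (simp add: t_def power2_eq_square)
  have "(\<Sum>p\<in>UNIV. t *\<^sub>R Z p) \<in> convex hull (outer ` sign_vectors)"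
  proof (rule convex_sum)
    fix p :: "'n \<times> 'n"
    obtain i j where p: "p = (i, j)" by (cases p)
    have "\<bar>C $ i $ j / 2\<bar> \<le> 1"
      using correlation_matrix_entry_bound[OF C, of i j] by simp
    then show "Z p \<in> convex hull (outer ` sign_vectors)"
      using single_pair_in_hull[of "C $ i $ j / 2" i j] by (simp add: Z_def p)
  qed (use card in \<open>auto simp: t_def\<close>)
  moreover have "(\<Sum>p\<in>UNIV. t *\<^sub>R Z p) = t *\<^sub>R C + (1 - t) *\<^sub>R mat 1"
  proof -
    have "(\<Sum>p\<in>UNIV. t *\<^sub>R Z p) $ k $ l = (t *\<^sub>R C + (1 - t) *\<^sub>R mat 1) $ k $ l" for k l
    proof (cases "k = l")
      case True
      then show ?thesis using card by (simp add: Z_def case_prod_beta mat_def diag)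
    next
      case False
      have "(\<Sum>p\<in>UNIV. t *\<^sub>R Z p) $ k $ l =
          (\<Sum>p\<in>UNIV. if p \<in> {(k, l), (l, k)} then t * (C $ fst p $ snd p / 2) else 0)"
        using False by (auto simp: Z_def case_prod_beta doubleton_eq_iff prod_eq_iff intro!: sum.cong)
      also have "\<dots> = (\<Sum>p\<in>{(k, l), (l, k)}. t * (C $ fst p $ snd p / 2))"
        by (subst sum.inter_restrict[symmetric]) auto
      also have "\<dots> = t * C $ k $ l"
        using False by (simp add: sym[of k l])
      finally show ?thesis using False by (simp add: mat_def)
    qed
    then show ?thesis by (simp add: vec_eq_iff)
  qed
  ultimately show ?thesis by simp
qed

text \<open>
  The factors in \<open>[0, 1]\<close> that work for all \<open>C\<close> form a compact set, the value 0 being included to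
  make it closed; its maximum is positive by the
  previous lemma and hence is the value of \<open>rho\<close>.
\<close>

lemma rho_scaled_in_hull:
  fixes C :: "real ^ 'n ^ 'n"
  assumes "correlation_matrix C" and "rank C \<le> r"
  shows "rho TYPE('n) r *\<^sub>R C + (1 - rho TYPE('n) r) *\<^sub>R mat 1
           \<in> convex hull (outer ` sign_vectors)"
proof -
  let ?K = "convex hull (outer ` (sign_vectors :: (real ^ 'n) set))"
  define T where "T = {0..1} \<inter> (\<Inter>C\<in>{C :: real ^ 'n ^ 'n. correlation_matrix C \<and> rank C \<le> r}.
    (\<lambda>t. t *\<^sub>R C + (1 - t) *\<^sub>R mat 1) -` ?K)"
  have T_iff: "t \<in> T \<longleftrightarrow> 0 \<le> t \<and> t \<le> 1 \<and> (\<forall>C :: real ^ 'n ^ 'n. correlation_matrix C \<and> rank C \<le> r \<longrightarrow>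
      t *\<^sub>R C + (1 - t) *\<^sub>R mat 1 \<in> ?K)" for t
    unfolding T_def by simp
  have "closed ?K"
    by (intro compact_imp_closed finite_imp_compact_convex_hull finite_imageI finite_sign_vectors)
  then have "closed ((\<lambda>t. t *\<^sub>R C + (1 - t) *\<^sub>R mat 1) -` ?K)" for C
    by (rule closed_vimage) (intro continuous_intros)
  then have "compact T"
    unfolding T_def by (intro compact_Int_closed compact_Icc closed_INT ballI)
  define t\<^sub>0 where "t\<^sub>0 = 1 / (real CARD('n))\<^sup>2"
  have t0: "0 < t\<^sub>0" "t\<^sub>0 \<le> 1"
    by (simp_all add: t\<^sub>0_def)
  have "t\<^sub>0 \<in> T"
    unfolding T_iff
  proof (intro conjI allI impI)
    fix C :: "real ^ 'n ^ 'n"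
    assume "correlation_matrix C \<and> rank C \<le> r"
    then show "t\<^sub>0 *\<^sub>R C + (1 - t\<^sub>0) *\<^sub>R mat 1 \<in> ?K"
      unfolding t\<^sub>0_def by (intro shrunk_correlation_matrix_in_hull) simp
  qed (use t0 in simp_all)
  then obtain t where t: "t \<in> T" "\<And>s. s \<in> T \<Longrightarrow> s \<le> t"
    using compact_attains_sup[OF \<open>compact T\<close>] by auto
  have "0 < t" using t(2)[OF \<open>t\<^sub>0 \<in> T\<close>] t0(1) by linarith
  have "rho TYPE('n) r = (GREATEST s. 0 < s \<and> s \<in> T)"
    unfolding rho_def rank_one_correlation_matrices T_iff
    by (rule arg_cong[where f = Greatest], rule ext) (iprover intro: less_imp_le)
  also have "\<dots> = t"
    by (rule Greatest_equality) (simp_all add: t \<open>0 < t\<close>)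
  finally have "rho TYPE('n) r = t" .
  then show ?thesis using t(1) assms unfolding T_iff by blast
qed

section \<open>From correlation matrices to unistochastic matrices\<close>

text \<open>
  The entry \<open>(i, j)\<close> of \<open>V D V\<^sup>*\<close> with \<open>D = diag v\<close> is the sum of \<open>v\<^sub>k V\<^sub>i\<^sub>k cnj V\<^sub>j\<^sub>k\<close> over \<open>k\<close>. Expanding its
  squared modulus gives the right-hand side below with \<open>E\<^sub>k\<^sub>l = v\<^sub>k v\<^sub>l\<close>.
\<close>

definition spectral_lift :: "complex ^ 'n ^ 'n \<Rightarrow> real ^ 'n ^ 'n \<Rightarrow> real ^ 'n ^ 'n" where
  "spectral_lift V E = (\<chi> i j. \<Sum>k\<in>UNIV. \<Sum>l\<in>UNIV.
     E $ k $ l * Re (V $ i $ k * cnj (V $ j $ k) * cnj (V $ i $ l * cnj (V $ j $ l))))"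

lemma linear_spectral_lift: "linear (spectral_lift V)"
  by (rule linearI)
    (simp_all add: spectral_lift_def vec_eq_iff distrib_right sum.distrib sum_distrib_left mult.assoc)

lemma spectral_lift_outer:
  "spectral_lift V (outer v) $ i $ j =
     (cmod (\<Sum>k\<in>UNIV. complex_of_real (v $ k) * (V $ i $ k * cnj (V $ j $ k))))\<^sup>2"
proof -
  let ?z = "\<lambda>k. V $ i $ k * cnj (V $ j $ k)"
  let ?s = "\<Sum>k\<in>UNIV. complex_of_real (v $ k) * ?z k"
  have "?s * cnj ?s = (\<Sum>k\<in>UNIV. \<Sum>l\<in>UNIV. complex_of_real (v $ k * v $ l) * (?z k * cnj (?z l)))"
    by (simp add: cnj_sum sum_product mult_ac)
  moreover have "Re (complex_of_real a * z) = a * Re z" for a z by simp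
  ultimately have "Re (?s * cnj ?s) = spectral_lift V (outer v) $ i $ j"
    by (simp only: Re_sum spectral_lift_def outer_def vec_lambda_beta)
  moreover have "Re (?s * cnj ?s) = (cmod ?s)\<^sup>2"
    by (metis Re_complex_of_real complex_norm_square)
  ultimately show ?thesis by simp
qed

lemma spectral_lift_outer_H_unistochastic:
  fixes V :: "complex ^ 'n ^ 'n"
  assumes V: "unitary_mat V" and v: "v \<in> sign_vectors"
  shows "H_unistochastic (spectral_lift V (outer v))"
proof -
  define D :: "complex ^ 'n ^ 'n" where
    "D = (\<chi> i j. if i = j then complex_of_real (v $ i) else 0)"
  define U where "U = V ** D ** conj_transpose V"
  have U_entry: "U $ i $ j = (\<Sum>k\<in>UNIV. complex_of_real (v $ k) * (V $ i $ k * cnj (V $ j $ k)))"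
    for i j
    by (simp add: U_def D_def matrix_matrix_mult_def conj_transpose_def if_distrib
        cong: if_cong) (simp add: mult_ac)
  have "hermitian_mat U"
    by (simp add: hermitian_mat_def vec_eq_iff conj_transpose_def U_entry cnj_sum mult_ac)
  have sq: "v $ i * v $ i = 1" for i
  proof -
    have "v $ i = 1 \<or> v $ i = -1" using v unfolding sign_vectors_def by blast
    then show ?thesis by auto
  qed
  have "D ** D = mat 1"
    by (simp add: D_def matrix_matrix_mult_def vec_eq_iff mat_def if_distrib[of "\<lambda>x. x * _"] sq
        flip: of_real_mult cong: if_cong)
  have "U ** U = V ** D ** (conj_transpose V ** V) ** D ** conj_transpose V"
    by (simp add: U_def matrix_mul_assoc)
  also have "\<dots> = V ** (D ** D) ** conj_transpose V"
    using V by (simp add: unitary_mat_def matrix_mul_assoc)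
  also have "\<dots> = mat 1"
    using V by (simp add: unitary_mat_def \<open>D ** D = mat 1\<close>)
  finally have "unitary_mat U"
    using \<open>hermitian_mat U\<close> by (simp add: unitary_mat_def hermitian_mat_def)
  then show ?thesis
    using \<open>hermitian_mat U\<close> unfolding H_unistochastic_def spectral_lift_outer U_entry[symmetric]
    by blast
qed

lemma spectral_lift_hull_in_B_h:
  assumes V: "unitary_mat V" and X: "X \<in> convex hull (outer ` sign_vectors)"
  shows "spectral_lift V X \<in> B_h"
proof -
  have "spectral_lift V X \<in> convex hull (spectral_lift V ` outer ` sign_vectors)"
    unfolding convex_hull_linear_image[OF linear_spectral_lift, symmetric] using X by blast
  also have "\<dots> \<subseteq> B_h"
    unfolding B_h_def
    by (rule hull_mono) (auto intro: spectral_lift_outer_H_unistochastic[OF V])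
  finally show ?thesis .
qed

section \<open>The Fourier matrix of a product of two cyclic groups\<close>

lemma sum_roots_of_unity:
  fixes d :: int
  assumes m: "0 < m"
  shows "(\<Sum>a<m. cis (2 * pi * (real a * of_int d / real m))) =
           (if int m dvd d then of_nat m else 0)"
proof -
  define z where "z = cis (2 * pi * (of_int d / real m))"
  have pow: "cis (2 * pi * (real a * of_int d / real m)) = z ^ a" for a
    by (simp add: z_def Complex.DeMoivre mult_ac)
  have "z ^ m = 1"
    using m by (simp add: z_def Complex.DeMoivre)
  have z1: "z = 1 \<longleftrightarrow> int m dvd d"
  proof -
    have "z = 1 \<longleftrightarrow> (\<exists>n::int. 2 * pi * (of_int d / real m) = of_int n * (2 * pi))"
      by (simp add: z_def cis_eq_1_iff)
    also have "\<dots> \<longleftrightarrow> (\<exists>n::int. real_of_int d = of_int (int m * n))"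
      using m by (simp add: field_simps)
    also have "\<dots> \<longleftrightarrow> int m dvd d"
      unfolding of_int_eq_iff dvd_def by blast
    finally show ?thesis .
  qed
  show ?thesis
  proof (cases "z = 1")
    case True
    then show ?thesis using z1 unfolding pow by simp
  next
    case False
    then show ?thesis using z1 \<open>z ^ m = 1\<close> unfolding pow by (simp add: sum_gp_strict)
  qed
qed

text \<open>
  A bijective labelling of the index type by pairs \<open>(r k, s k)\<close> identifies it with the group
  \<open>\<int>/m \<times> \<int>/q\<close>.
\<close>

definition fourier_matrix :: "nat \<Rightarrow> nat \<Rightarrow> ('n \<Rightarrow> nat) \<Rightarrow> ('n \<Rightarrow> nat) \<Rightarrow> complex ^ 'n ^ 'n" where
  "fourier_matrix m q r s = (\<chi> i k.
     cis (2 * pi * (real (r k) * real (r i) / real m + real (s k) * real (s i) / real q))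
       / complex_of_real (sqrt (real CARD('n))))"

locale product_labelling =
  fixes m q :: nat and r s :: "'n::finite \<Rightarrow> nat"
  assumes m_pos: "0 < m" and q_pos: "0 < q"
    and labelling: "bij_betw (\<lambda>k. (r k, s k)) UNIV ({..<m} \<times> {..<q})"
begin

lemma label_less: "r k < m" "s k < q"
  using labelling unfolding bij_betw_def by auto

lemma label_eq_iff: "k = l \<longleftrightarrow> r k = r l \<and> s k = s l"
  using labelling unfolding bij_betw_def inj_on_def by auto

lemma card_index: "CARD('n) = m * q"
  using bij_betw_same_card[OF labelling] by simp

lemma sum_characters:
  fixes d e :: int
  shows "(\<Sum>k\<in>UNIV. cis (2 * pi * (real (r k) * of_int d / real m + real (s k) * of_int e / real q))) =
     (if int m dvd d \<and> int q dvd e then of_nat CARD('n) else 0)"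
proof -
  have "(\<Sum>k\<in>UNIV. cis (2 * pi * (real (r k) * of_int d / real m + real (s k) * of_int e / real q))) =
      (\<Sum>k\<in>UNIV. case (r k, s k) of (a, b) \<Rightarrow>
         cis (2 * pi * (real a * of_int d / real m)) * cis (2 * pi * (real b * of_int e / real q)))"
    by (simp add: cis_mult distrib_left)
  also have "\<dots> = (\<Sum>(a, b)\<in>{..<m} \<times> {..<q}.
         cis (2 * pi * (real a * of_int d / real m)) * cis (2 * pi * (real b * of_int e / real q)))"
    by (rule sum.reindex_bij_betw[OF labelling])
  also have "\<dots> = (\<Sum>a<m. cis (2 * pi * (real a * of_int d / real m))) *
      (\<Sum>b<q. cis (2 * pi * (real b * of_int e / real q)))"
    by (simp add: sum_product sum.cartesian_product)
  also have "\<dots> = (if int m dvd d \<and> int q dvd e then of_nat CARD('n) else 0)"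
    unfolding sum_roots_of_unity[OF m_pos] sum_roots_of_unity[OF q_pos] card_index by simp
  finally show ?thesis .
qed

lemma dvd_label_diff:
  "int m dvd int (r k) - int (r l) \<longleftrightarrow> r k = r l"
  "int q dvd int (s k) - int (s l) \<longleftrightarrow> s k = s l"
proof -
  have "int m dvd int (r k) - int (r l) \<longleftrightarrow> int (r k) mod int m = int (r l) mod int m"
    by (simp add: mod_eq_dvd_iff)
  then show "int m dvd int (r k) - int (r l) \<longleftrightarrow> r k = r l"
    using label_less by simp
  have "int q dvd int (s k) - int (s l) \<longleftrightarrow> int (s k) mod int q = int (s l) mod int q"
    by (simp add: mod_eq_dvd_iff)
  then show "int q dvd int (s k) - int (s l) \<longleftrightarrow> s k = s l"
    using label_less by simp
qed

abbreviation V :: "complex ^ 'n ^ 'n" where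
  "V \<equiv> fourier_matrix m q r s"

lemma fourier_matrix_mult_cnj:
  "V $ i $ k * cnj (V $ j $ k) =
     cis (2 * pi * (real (r k) * of_int (int (r i) - int (r j)) / real m
                  + real (s k) * of_int (int (s i) - int (s j)) / real q)) / of_nat CARD('n)"
proof -
  have "complex_of_real (sqrt (real CARD('n))) * complex_of_real (sqrt (real CARD('n))) =
      of_nat CARD('n)"
    by (simp flip: of_real_mult)
  then show ?thesis
    by (simp add: fourier_matrix_def cis_cnj cis_mult) (simp add: algebra_simps diff_divide_distrib)
qed

lemma unitary_fourier_matrix: "unitary_mat V"
proof -
  have "V ** conj_transpose V = mat 1"
    using label_eq_iff
    by (simp add: vec_eq_iff matrix_matrix_mult_def conj_transpose_def fourier_matrix_mult_cnj
        mat_def sum_characters dvd_label_diff flip: sum_divide_distrib del: of_int_diff)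
  then show ?thesis
    using matrix_left_right_inverse unfolding unitary_mat_def by blast
qed

lemma spectral_lift_mat_1: "spectral_lift V (mat 1) = W_mat"
proof -
  have "Re (V $ i $ k * cnj (V $ j $ k) * cnj (V $ i $ k * cnj (V $ j $ k))) =
      1 / (real CARD('n))\<^sup>2" for i j k
  proof -
    have "cmod (V $ i $ k * cnj (V $ j $ k)) = 1 / real CARD('n)"
      unfolding fourier_matrix_mult_cnj by (simp add: norm_divide)
    then show ?thesis
      by (metis Re_complex_of_real complex_norm_square power_one_over)
  qed
  then show ?thesis
    by (simp add: spectral_lift_def W_mat_def vec_eq_iff mat_def if_distrib[of "\<lambda>x. x * _"]
        power2_eq_square cong: if_cong)
qed

section \<open>The Katz matrix as the image of a correlation matrix of rank two\<close>

definition cos_vector :: "real ^ 'n" where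
  "cos_vector = (\<chi> k. cos (2 * pi * (real (r k) / real m)))"

definition sin_vector :: "real ^ 'n" where
  "sin_vector = (\<chi> k. sin (2 * pi * (real (r k) / real m)))"

text \<open>
  By the parallelogram law the multipliers \<open>cos\<close> and \<open>sin\<close> may be replaced by the two characters
  \<open>cos \<plusminus> \<i> sin\<close>; each of these shifts the first difference of labels by one, and orthogonality of
  characters leaves an indicator.
\<close>

lemma spectral_lift_cos_sin:
  "spectral_lift V (outer cos_vector + outer sin_vector) $ i $ j =
     (if s i = s j then
        (of_bool (int m dvd int (r i) - int (r j) + 1) + of_bool (int m dvd int (r i) - int (r j) - 1)) / 2
      else 0)"
proof -
  let ?z = "\<lambda>k. V $ i $ k * cnj (V $ j $ k)"
  define x where "x = (\<Sum>k\<in>UNIV. complex_of_real (cos_vector $ k) * ?z k)"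
  define y where "y = (\<Sum>k\<in>UNIV. complex_of_real (sin_vector $ k) * ?z k)"
  have shift: "(\<Sum>k\<in>UNIV. cis (2 * pi * (real (r k) * of_int e / real m)) * ?z k) =
      of_bool (int m dvd int (r i) - int (r j) + e \<and> s i = s j)" for e :: int
  proof -
    have "(\<Sum>k\<in>UNIV. cis (2 * pi * (real (r k) * of_int e / real m)) * ?z k) =
        (\<Sum>k\<in>UNIV. cis (2 * pi * (real (r k) * of_int (int (r i) - int (r j) + e) / real m
           + real (s k) * of_int (int (s i) - int (s j)) / real q))) / of_nat CARD('n)"
      unfolding fourier_matrix_mult_cnj times_divide_eq_right sum_divide_distrib[symmetric] cis_mult
      by (simp add: algebra_simps add_divide_distrib diff_divide_distrib)
    then show ?thesis
      unfolding sum_characters dvd_label_diff by simp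
  qed
  have "x + \<i> * y = (\<Sum>k\<in>UNIV. cis (2 * pi * (real (r k) * of_int 1 / real m)) * ?z k)"
  proof -
    have "cis (2 * pi * (real (r k) * of_int 1 / real m)) =
        complex_of_real (cos_vector $ k) + \<i> * complex_of_real (sin_vector $ k)" for k
      by (simp add: cos_vector_def sin_vector_def complex_eq_iff)
    then show ?thesis
      by (simp add: x_def y_def sum_distrib_left sum.distrib[symmetric] distrib_right mult.assoc)
  qed
  then have plus: "x + \<i> * y = of_bool (int m dvd int (r i) - int (r j) + 1 \<and> s i = s j)"
    unfolding shift .
  have "x - \<i> * y = (\<Sum>k\<in>UNIV. cis (2 * pi * (real (r k) * of_int (-1) / real m)) * ?z k)"
  proof -
    have "cis (2 * pi * (real (r k) * of_int (-1) / real m)) =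
        complex_of_real (cos_vector $ k) - \<i> * complex_of_real (sin_vector $ k)" for k
      by (simp add: cos_vector_def sin_vector_def complex_eq_iff)
    then show ?thesis
      by (simp add: x_def y_def sum_distrib_left sum_subtractf[symmetric] left_diff_distrib mult.assoc)
  qed
  then have minus: "x - \<i> * y = of_bool (int m dvd int (r i) - int (r j) - 1 \<and> s i = s j)"
    unfolding shift by simp
  have "spectral_lift V (outer cos_vector + outer sin_vector) $ i $ j = (cmod x)\<^sup>2 + (cmod y)\<^sup>2"
    by (simp add: linear_add[OF linear_spectral_lift] spectral_lift_outer x_def y_def)
  also have "\<dots> = ((cmod (x + \<i> * y))\<^sup>2 + (cmod (x - \<i> * y))\<^sup>2) / 2"
    unfolding cmod_power2 by (simp add: power2_eq_square algebra_simps)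
  finally show ?thesis
    unfolding plus minus by (cases "s i = s j") simp_all
qed

end

text \<open>
  The two congruences exclude each other for odd \<open>m \<ge> 3\<close> and are equivalent for \<open>m = 1\<close> and \<open>m = 2\<close>; this
  is why the average reproduces the exceptional small blocks as well.
\<close>

lemma katz_block_eq_average:
  assumes m: "odd m \<or> m = 2" and ab: "a < m" "b < m"
  shows "katz_block m a b =
     (of_bool (int m dvd int a - int b + 1) + of_bool (int m dvd int a - int b - 1)) / 2"
proof -
  consider "m = 1" | "m = 2" | "odd m" "m \<ge> 3"
  proof -
    have "m \<noteq> 0" using ab by simp
    then show ?thesis using m that by (cases "m \<ge> 3") (auto simp: not_le numeral_3_eq_3 less_Suc_eq)
  qed
  then show ?thesis
  proof cases
    case 1
    then show ?thesis by (simp add: katz_block_def)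
  next
    case 2
    then have "(a = 0 \<or> a = 1) \<and> (b = 0 \<or> b = 1)" using ab by auto
    then show ?thesis using 2 by (auto simp: katz_block_def)
  next
    case 3
    have "\<not> (int m dvd int a - int b + 1 \<and> int m dvd int a - int b - 1)"
    proof
      assume "int m dvd int a - int b + 1 \<and> int m dvd int a - int b - 1"
      then have "int m dvd (int a - int b + 1) - (int a - int b - 1)"
        using dvd_diff by blast
      then have "int m dvd 2" by simp
      then show False using 3 zdvd_imp_le[of "int m" 2] by simp
    qed
    then show ?thesis
      using 3 by (auto simp: katz_block_def cong_iff_dvd_diff)
  qed
qed

lemma block_diag_replicate:
  assumes "i < m * q" "j < m * q"
  shows "block_diag (replicate q m) i j =
     (if i div m = j div m then katz_block m (i mod m) (j mod m) else 0)"
  using assms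
proof (induction q arbitrary: i j)
  case 0
  then show ?case by simp
next
  case (Suc q)
  then have m: "0 < m" by (cases m) auto
  show ?case
  proof (cases "m \<le> i \<and> m \<le> j")
    case True
    then have "i - m < m * q" "j - m < m * q" using Suc.prems by auto
    then show ?thesis
      using True m Suc.IH[of "i - m" "j - m"] by (simp add: le_div_geq le_mod_geq)
  next
    case False
    then show ?thesis using m by (auto simp: not_le div_eq_0_iff)
  qed
qed

lemma conj_permutation_matrix_entry:
  fixes M :: "real ^ 'n ^ 'n"
  assumes P: "P = (\<chi> i j. if j = p i then 1 else 0)"
  shows "(P ** M ** transpose P) $ i $ j = M $ p i $ p j"
  by (simp add: P matrix_matrix_mult_def transpose_def if_distrib if_distribR cong: if_cong)

lemma katz_blocks_labelling:
  fixes M :: "real ^ 'n ^ 'n"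
  assumes m: "0 < m" and q: "0 < q" and card: "m * q = CARD('n)"
    and M: "has_katz_blocks M (replicate q m)"
  obtains r s where "product_labelling m q r s"
    and "\<And>i j. M $ i $ j = (if s i = s j then katz_block m (r i) (r j) else 0)"
proof -
  obtain P where P: "permutation_matrix P" and eq: "P ** M ** transpose P = katz_matrix (replicate q m)"
    using M unfolding has_katz_blocks_def by blast
  obtain p where p: "p permutes (UNIV :: 'n set)" and Pp: "P = (\<chi> i j. if j = p i then 1 else 0)"
    using P unfolding permutation_matrix_def by blast
  define f where "f = to_nat_on (UNIV :: 'n set) \<circ> inv p"
  have f: "bij_betw f UNIV {..<m * q}"
    unfolding f_def card
    by (rule bij_betw_trans[OF permutes_imp_bij[OF permutes_inv[OF p]] to_nat_on_finite]) simp
  have pair: "bij_betw (\<lambda>x. (x mod m, x div m)) {..<m * q} ({..<m} \<times> {..<q})"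
  proof (rule bij_betw_byWitness[where f' = "\<lambda>(a, b). a + m * b"])
    show "(\<lambda>(a, b). a + m * b) ` ({..<m} \<times> {..<q}) \<subseteq> {..<m * q}"
    proof clarsimp
      fix a b assume "a < m" "b < q"
      then have "a + m * b < m * Suc b" by simp
      also have "\<dots> \<le> m * q" using \<open>b < q\<close> by (intro mult_le_mono2) simp
      finally show "a + m * b < m * q" .
    qed
  qed (use m in \<open>auto simp: less_mult_imp_div_less mult.commute\<close>)
  have "product_labelling m q (\<lambda>k. f k mod m) (\<lambda>k. f k div m)"
    using m q bij_betw_trans[OF f pair] by (simp add: product_labelling_def o_def)
  moreover have "M $ i $ j =
      (if f i div m = f j div m then katz_block m (f i mod m) (f j mod m) else 0)" for i j
  proof -
    have "M $ i $ j = M $ p (inv p i) $ p (inv p j)"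
      using p by (simp add: permutes_inverses)
    also have "\<dots> = katz_matrix (replicate q m) $ inv p i $ inv p j"
      using conj_permutation_matrix_entry[OF Pp, of M] eq by metis
    also have "\<dots> = block_diag (replicate q m) (f i) (f j)"
      by (simp add: katz_matrix_def f_def)
    also have "\<dots> = (if f i div m = f j div m then katz_block m (f i mod m) (f j mod m) else 0)"
      using f by (intro block_diag_replicate) (auto simp: bij_betw_def)
    finally show ?thesis .
  qed
  ultimately show ?thesis using that by blast
qed

theorem proposition5:
  fixes M :: "real ^ 'n ^ 'n" and m q :: nat
  assumes "3 \<le> CARD('n)"
    and "0 < m" and "0 < q" and "m * q = CARD('n)"
    and "M extreme_point_of {A :: real ^ 'n ^ 'n. symmetric_bistochastic A}"
    and "has_katz_blocks M (replicate q m)"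
  shows "rho TYPE('n) 2 *\<^sub>R M + (1 - rho TYPE('n) 2) *\<^sub>R W_mat \<in> B_h"
proof -
  have odd: "odd m \<or> m = 2"
    using assms(3,6) unfolding has_katz_blocks_def by simp
  obtain r s where "product_labelling m q r s"
    and M: "\<And>i j. M $ i $ j = (if s i = s j then katz_block m (r i) (r j) else 0)"
    using katz_blocks_labelling[OF assms(2,3,4,6)] by blast
  then interpret product_labelling m q r s by simp
  define C where "C = outer cos_vector + outer sin_vector"
  have "correlation_matrix C"
    unfolding C_def
    by (rule correlation_matrix_sum_outer) (simp add: cos_vector_def sin_vector_def)
  moreover have "rank C \<le> 2"
    unfolding C_def by (rule rank_sum_outer)
  ultimately have "spectral_lift V (rho TYPE('n) 2 *\<^sub>R C + (1 - rho TYPE('n) 2) *\<^sub>R mat 1) \<in> B_h"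
    by (intro spectral_lift_hull_in_B_h unitary_fourier_matrix rho_scaled_in_hull)
  moreover have "spectral_lift V C = M"
    using label_less
    by (simp add: vec_eq_iff C_def spectral_lift_cos_sin M katz_block_eq_average[OF odd])
  ultimately show ?thesis
    by (simp add: linear_add[OF linear_spectral_lift] linear_scale[OF linear_spectral_lift]
        spectral_lift_mat_1)
qed

end
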